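(* Let $\mathcal B$ be a Muckenhoupt basis in $\mathbf R^n$. Let $\frac1m<p<\infty$ and $1<p_1,\dots,p_m<\infty$ be such that $\frac1p=\frac1{p_1}+\cdots+\frac1{p_m}$. If the weights $(\nu,\vec w\,)=(\nu,w_1,\dots,w_m)$ satisfy the power bump condition $$\sup_{B\in\mathcal B}\left(\frac1{|B|}\int_B\nu(x)\,dx\right)\prod_{j=1}^m\left(\frac1{|B|}\int_B w_j^{(1-p_j')r}\,dx\right)^{\frac{p}{p_j'r}}<\infty$$ for some $r>1$, and $\nu$ satisfies condition $(A)$, then $\mathcal M_{\mathcal B}$ is bounded from $L^{p_1}(w_1)\times\cdots\times L^{p_m}(w_m)$ to $L^p(\nu)$.
   Context: A basis $\mathcal B$ in $\mathbf R^n$ is a collection of open sets in $\mathbf R^n$ (non-empty and of finite Lebesgue measure, so that averages make sense). A weight associated with $\mathcal B$ is a non-negative measurable function $w$ on $\mathbf R^n$ with $w(B)=\int_B w\,dx<\infty$ for every $B\in\mathcal B$; we write $w(E)=\int_E w\,dx$. $L^q(w)$ denotes $L^q(\mathbf R^n,w\,dx)$, and $q'=q/(q-1)$ is the conjugate exponent. Define $$\mathcal M_{\mathcal B}(\vec f\,)(x)=\sup_{B\in\mathcal B,\,B\ni x}\ \prod_{j=1}^m\frac1{|B|}\int_B|f_j(y)|\,dy,\qquad M_{\mathcal B}f(x)=\sup_{B\in\mathcal B,\,B\ni x}\frac1{|B|}\int_B|f(y)|\,dy .$$ An $m$-(sub)linear operator $T$ is bounded from $X_1\times\cdots\times X_m$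 to $Y$ if $\|T(\vec f\,)\|_Y\le C\prod_{j=1}^m\|f_j\|_{X_j}$ for a constant $C$ independent of $\vec f$. For $1<q<\infty$, a weight $w$ belongs to $A_{q,\mathcal B}$ if $$\sup_{B\in\mathcal B}\left(\frac1{|B|}\int_B w\,dx\right)\left(\frac1{|B|}\int_B w^{1-q'}\,dx\right)^{q/q'}<\infty .$$ $\mathcal B$ is a Muckenhoupt basis if for every $1<q<\infty$ and every $w\in A_{q,\mathcal B}$, $M_{\mathcal B}$ is bounded on $L^q(w)$. Condition $(A)$ (relative to $\mathcal B$): a weight $w$ associated with $\mathcal B$ satisfies $(A)$ if there are constants $0<\lambda<1$ and $0<c(\lambda)<\infty$ such that $$w\big(\{x\in\mathbf R^n: M_{\mathcal B}(\chi_E)(x)>\lambda\}\big)\le c(\lambda)\,w(E)$$ for all measurable sets $E$. *)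

theory Defs
  imports "HOL-Analysis.Analysis"
begin

text \<open>
  Integrals, averages and norms of nonnegative functions are taken in \<^typ>\<open>ennreal\<close>, where
  \<open>0 * \<infinity> = 0\<close>. Vectors \<open>(f\<^sub>1, \<dots>, f\<^sub>m)\<close>, \<open>(w\<^sub>1, \<dots>, w\<^sub>m)\<close>, \<open>(p\<^sub>1, \<dots>, p\<^sub>m)\<close> are functions on
  \<^typ>\<open>nat\<close> of which only the values on \<open>{1..m}\<close> matter.
\<close>

text \<open>
  Real powers on \<open>[0, \<infinity>]\<close>. Since a weight may vanish, \<open>w powr a\<close> with \<open>a < 0\<close> has to take the
  value \<open>\<infinity>\<close> where \<open>w = 0\<close>, unlike the real \<open>powr\<close>, for which \<open>0 powr a = 0\<close>.
\<close>
definition epowr :: "ennreal \<Rightarrow> real \<Rightarrow> ennreal" (infixr \<open>epowr\<close> 80) where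
  "x epowr a =
     (if a = 0 then 1
      else if x = 0 then (if a < 0 then \<infinity> else 0)
      else if x = \<infinity> then (if a < 0 then 0 else \<infinity>)
      else ennreal (enn2real x powr a))"

definition conj_exp :: "real \<Rightarrow> real" where
  "conj_exp q = q / (q - 1)"

definition avg :: "(real ^ 'n) set \<Rightarrow> (real ^ 'n \<Rightarrow> ennreal) \<Rightarrow> ennreal" where
  "avg B g = (\<integral>\<^sup>+x\<in>B. g x \<partial>lebesgue) / emeasure lebesgue B"

definition is_basis :: "(real ^ 'n) set set \<Rightarrow> bool" where
  "is_basis \<B> \<longleftrightarrow> (\<forall>B\<in>\<B>. open B \<and> B \<noteq> {} \<and> emeasure lebesgue B < \<infinity>)"

text \<open>The measure \<open>w dx\<close>; thus \<open>w(E)\<close> is \<open>emeasure (weighted w) E\<close>.\<close>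
definition weighted :: "(real ^ 'n \<Rightarrow> real) \<Rightarrow> (real ^ 'n) measure" where
  "weighted w = density lebesgue (\<lambda>x. ennreal (w x))"

definition is_weight :: "(real ^ 'n) set set \<Rightarrow> (real ^ 'n \<Rightarrow> real) \<Rightarrow> bool" where
  "is_weight \<B> w \<longleftrightarrow>
     w \<in> borel_measurable lebesgue \<and> (\<forall>x. 0 \<le> w x) \<and>
     (\<forall>B\<in>\<B>. emeasure (weighted w) B < \<infinity>)"

definition Lnorm :: "real \<Rightarrow> (real ^ 'n \<Rightarrow> real) \<Rightarrow> (real ^ 'n \<Rightarrow> ennreal) \<Rightarrow> ennreal" where
  "Lnorm q w g = (\<integral>\<^sup>+x. g x epowr q \<partial>weighted w) epowr (1 / q)"

definition Lspace :: "real \<Rightarrow> (real ^ 'n \<Rightarrow> real) \<Rightarrow> (real ^ 'n \<Rightarrow> real) set" where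
  "Lspace q w =
     {f. f \<in> borel_measurable lebesgue \<and> Lnorm q w (\<lambda>x. ennreal \<bar>f x\<bar>) < \<infinity>}"

text \<open>A point lying in no member of the basis gets the value \<open>0\<close>, the supremum of the empty set.\<close>
definition multi_maximal ::
    "(real ^ 'n) set set \<Rightarrow> nat \<Rightarrow> (nat \<Rightarrow> real ^ 'n \<Rightarrow> real) \<Rightarrow> real ^ 'n \<Rightarrow> ennreal" where
  "multi_maximal \<B> m f x =
     (SUP B\<in>{B\<in>\<B>. x \<in> B}. \<Prod>j=1..m. avg B (\<lambda>y. ennreal \<bar>f j y\<bar>))"

definition maximal :: "(real ^ 'n) set set \<Rightarrow> (real ^ 'n \<Rightarrow> real) \<Rightarrow> real ^ 'n \<Rightarrow> ennreal" where
  "maximal \<B> f x = (SUP B\<in>{B\<in>\<B>. x \<in> B}. avg B (\<lambda>y. ennreal \<bar>f y\<bar>))"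

text \<open>
  Boundedness of \<open>T\<close> from \<open>L\<^sup>q\<^sup>1(w\<^sub>1) \<times> \<dots> \<times> L\<^sup>q\<^sup>m(w\<^sub>m)\<close> to \<open>L\<^sup>p(v)\<close>. The values of \<open>T\<close> are
  \<open>[0, \<infinity>]\<close>-valued functions; they lie in \<open>L\<^sup>p(v)\<close> because the right-hand side is finite.
\<close>
definition bounded_op ::
    "nat \<Rightarrow> ((nat \<Rightarrow> real ^ 'n \<Rightarrow> real) \<Rightarrow> real ^ 'n \<Rightarrow> ennreal) \<Rightarrow>
     (nat \<Rightarrow> real) \<Rightarrow> (nat \<Rightarrow> real ^ 'n \<Rightarrow> real) \<Rightarrow> real \<Rightarrow> (real ^ 'n \<Rightarrow> real) \<Rightarrow> bool" where
  "bounded_op m T q w p v \<longleftrightarrow>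
     (\<exists>C::real. \<forall>f. (\<forall>j\<in>{1..m}. f j \<in> Lspace (q j) (w j)) \<longrightarrow>
        T f \<in> borel_measurable lebesgue \<and>
        Lnorm p v (T f) \<le> ennreal C * (\<Prod>j=1..m. Lnorm (q j) (w j) (\<lambda>x. ennreal \<bar>f j x\<bar>)))"

text \<open>
  A weight vanishing almost everywhere on some \<open>B\<close> contributes \<open>0 * \<infinity> = 0\<close> for that \<open>B\<close>. The
  convention \<open>0 * \<infinity> = \<infinity>\<close> would lead to the same Muckenhoupt bases: the union \<open>U\<close> of the members
  on which a weight of \<open>A_class\<close> vanishes meets no other member of the basis, and replacing the
  weight by \<open>1\<close> on \<open>U\<close> removes the degenerate members.
\<close>
definition A_class :: "real \<Rightarrow> (real ^ 'n) set set \<Rightarrow> (real ^ 'n \<Rightarrow> real) set" where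
  "A_class q \<B> =
     {w. is_weight \<B> w \<and>
         (SUP B\<in>\<B>. avg B (\<lambda>x. ennreal (w x)) *
            (avg B (\<lambda>x. ennreal (w x) epowr (1 - conj_exp q))) epowr (q / conj_exp q)) < \<infinity>}"

definition muckenhoupt_basis :: "(real ^ 'n) set set \<Rightarrow> bool" where
  "muckenhoupt_basis \<B> \<longleftrightarrow>
     is_basis \<B> \<and>
     (\<forall>q>1. \<forall>w\<in>A_class q \<B>.
        bounded_op 1 (\<lambda>f. maximal \<B> (f 1)) (\<lambda>_. q) (\<lambda>_. w) q w)"

definition condition_A :: "(real ^ 'n) set set \<Rightarrow> (real ^ 'n \<Rightarrow> real) \<Rightarrow> bool" where
  "condition_A \<B> w \<longleftrightarrow>
     (\<exists>l c::real. 0 < l \<and> l < 1 \<and> 0 < c \<and>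
        (\<forall>E\<in>sets lebesgue.
           emeasure (weighted w) {x. ennreal l < maximal \<B> (indicat_real E) x}
             \<le> ennreal c * emeasure (weighted w) E))"

end

theory Submission
  imports Defs
begin

text \<open>
  Write \<open>a(B)\<close> for the product of the averages of the \<open>|f\<^sub>j|\<close> over \<open>B\<close>. It is enough to bound the
  integral of the \<open>p\<close>-th power of the supremum of \<open>a(B)\<close> over those \<open>B\<close> in a finite subfamily
  that contain the point, uniformly in the subfamily (\<open>nn_integral_basis_sup_le\<close>). From the
  subfamily, in the order of decreasing \<open>a(B)\<close>, one selects those sets of which at most the
  fraction \<open>l\<close> is covered by the sets selected before (\<open>greedy_selection\<close>), where \<open>l\<close> is the
  constant of condition (A). For every height, the sets whose value \<open>a(B)\<close> exceeds it are contained
  in the set where the maximal function of the indicator of the union of the selected ones among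
  them exceeds \<open>l\<close>. Condition (A) and the layer cake formula therefore bound the integral by a
  multiple of \<open>\<Sum> a(B)\<^sup>p \<nu>(B)\<close> over the selected sets (\<open>covering_bound\<close>).

  Set \<open>s\<^sub>j = (p\<^sub>j' r)' < p\<^sub>j\<close> and \<open>h\<^sub>j = (|f\<^sub>j| w\<^sub>j powr (1 / p\<^sub>j)) powr s\<^sub>j\<close>. Hoelder's inequality on
  \<open>B\<close> with the exponents \<open>s\<^sub>j\<close> and \<open>p\<^sub>j' r\<close>, and the bump condition, remove all weights:
  \<open>a(B)\<^sup>p \<nu>(B)\<close> is at most a multiple of \<open>|B|\<close> times the product of the powers \<open>p / s\<^sub>j\<close> of the
  averages of \<open>h\<^sub>j\<close> (\<open>bump_term_bound\<close>). The selected sets contain disjoint parts of comparable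
  Lebesgue measure, so the sum is at most a multiple of the integral of
  \<open>\<Prod> (M h\<^sub>j) powr (p / s\<^sub>j)\<close> (\<open>sum_avg_le_nn_integral_maximal\<close>). Since \<open>\<Sum> p / p\<^sub>j = 1\<close>, Hoelder's
  inequality separates the factors; the maximal operator is bounded on the unweighted \<open>L\<^sup>q\<close> with
  \<open>q = p\<^sub>j / s\<^sub>j > 1\<close>, and the integral of \<open>h\<^sub>j powr q\<close> is that of \<open>|f\<^sub>j| powr p\<^sub>j w\<^sub>j\<close>.
\<close>

section \<open>Real powers on the extended nonnegative reals\<close>

lemma epowr_ennreal_pos: "0 < x \<Longrightarrow> ennreal x epowr a = ennreal (x powr a)"
  by (auto simp: epowr_def)

lemma epowr_ennreal: "0 \<le> x \<Longrightarrow> 0 < a \<Longrightarrow> ennreal x epowr a = ennreal (x powr a)"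
  by (auto simp: epowr_def)

lemma epowr_zero_left [simp]: "0 < a \<Longrightarrow> 0 epowr a = 0"
  and epowr_top_left [simp]: "0 < a \<Longrightarrow> \<infinity> epowr a = \<infinity>" "0 < a \<Longrightarrow> top epowr a = top"
  and epowr_one_left [simp]: "1 epowr a = 1"
  and epowr_one_right [simp]: "x epowr 1 = x"
  by (auto simp: epowr_def top_unique powr_one' less_top)

lemma epowr_eq_0_iff: "0 < a \<Longrightarrow> x epowr a = 0 \<longleftrightarrow> x = 0"
  by (auto simp: epowr_def enn2real_eq_0_iff)

lemma epowr_eq_top_iff: "0 < a \<Longrightarrow> x epowr a = top \<longleftrightarrow> x = top"
  by (auto simp: epowr_def)

lemma epowr_less_top_iff: "0 < a \<Longrightarrow> x epowr a < top \<longleftrightarrow> x < top"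
  by (simp add: epowr_eq_top_iff flip: less_top)

lemma epowr_zero_neg: "a < 0 \<Longrightarrow> 0 epowr a = \<infinity>"
  by (simp add: epowr_def)

lemma epowr_mono: "0 < a \<Longrightarrow> x \<le> y \<Longrightarrow> x epowr a \<le> y epowr a"
  by (cases x; cases y) (auto simp: epowr_ennreal powr_mono2 ennreal_leI top_unique)

lemma epowr_epowr: "0 < a \<Longrightarrow> 0 < b \<Longrightarrow> (x epowr a) epowr b = x epowr (a * b)"
  by (cases x) (auto simp: epowr_ennreal powr_powr)

lemma epowr_mult: "0 < a \<Longrightarrow> (x * y) epowr a = x epowr a * y epowr a"
  by (cases x; cases y)
     (auto simp: epowr_ennreal powr_mult ennreal_mult[symmetric] ennreal_mult_top ennreal_top_mult)

lemma epowr_prod: "0 < a \<Longrightarrow> (\<Prod>i\<in>I. x i) epowr a = (\<Prod>i\<in>I. x i epowr a)"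
  by (induction I rule: infinite_finite_induct) (auto simp: epowr_mult)

lemma epowr_SUP:
  assumes "0 < a"
  shows "(SUP i\<in>I. x i) epowr a = (SUP i\<in>I. x i epowr a)"
proof (rule antisym)
  have "(SUP i\<in>I. x i) \<le> (SUP i\<in>I. x i epowr a) epowr (1 / a)"
  proof (rule SUP_least)
    fix i assume "i \<in> I"
    then have "(x i epowr a) epowr (1 / a) \<le> (SUP i\<in>I. x i epowr a) epowr (1 / a)"
      using assms by (intro epowr_mono SUP_upper) auto
    then show "x i \<le> (SUP i\<in>I. x i epowr a) epowr (1 / a)"
      using assms by (simp add: epowr_epowr)
  qed
  from epowr_mono[OF assms this] show "(SUP i\<in>I. x i) epowr a \<le> (SUP i\<in>I. x i epowr a)"
    using assms by (simp add: epowr_epowr)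
  show "(SUP i\<in>I. x i epowr a) \<le> (SUP i\<in>I. x i) epowr a"
    using assms by (intro SUP_least epowr_mono SUP_upper)
qed

lemma measurable_epowr [measurable]:
  assumes [measurable]: "f \<in> borel_measurable M"
  shows "(\<lambda>x. f x epowr a) \<in> borel_measurable M"
  unfolding epowr_def by measurable

section \<open>Hoelder's inequality in the extended nonnegative reals\<close>

lemma prod_mono_ennreal:
  fixes a b :: "'i \<Rightarrow> ennreal"
  assumes "\<And>i. i \<in> I \<Longrightarrow> a i \<le> b i"
  shows "(\<Prod>i\<in>I. a i) \<le> (\<Prod>i\<in>I. b i)"
  using assms by (induction I rule: infinite_finite_induct) (auto intro: mult_mono)

text \<open>
  Jensen's inequality for \<open>exp\<close> at the logarithms of the \<open>x i\<close>, when these are positive and finite.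
\<close>
lemma weighted_AM_GM_ennreal:
  fixes x :: "'a \<Rightarrow> ennreal" and \<theta> :: "'a \<Rightarrow> real"
  assumes I: "finite I" and \<theta>: "\<And>i. i \<in> I \<Longrightarrow> 0 < \<theta> i" "(\<Sum>i\<in>I. \<theta> i) = 1"
  shows "(\<Prod>i\<in>I. x i epowr \<theta> i) \<le> (\<Sum>i\<in>I. ennreal (\<theta> i) * x i)"
proof -
  consider "\<exists>i\<in>I. x i = 0" | "\<exists>i\<in>I. x i = top" | "\<forall>i\<in>I. x i \<noteq> 0 \<and> x i \<noteq> top"
    by blast
  then show ?thesis
  proof cases
    case 1
    then have "\<exists>i\<in>I. x i epowr \<theta> i = 0"
      using \<theta>(1) by (auto simp: epowr_eq_0_iff)
    then have "(\<Prod>i\<in>I. x i epowr \<theta> i) = 0"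
      using I by (rule prod_zero[rotated])
    then show ?thesis by (metis zero_le)
  next
    case 2
    then obtain i where i: "i \<in> I" "x i = top" by blast
    have "ennreal (\<theta> i) * x i \<le> (\<Sum>i\<in>I. ennreal (\<theta> i) * x i)"
      using I i by (intro member_le_sum) auto
    then show ?thesis
      using \<theta>(1)[OF i(1)] i by (simp add: ennreal_mult_top top_unique)
  next
    case 3
    define u where "u i = enn2real (x i)" for i
    have u: "x i = ennreal (u i)" "0 < u i" if "i \<in> I" for i
      using 3 that by (auto simp: u_def less_top enn2real_positive_iff zero_less_iff_neq_zero)
    have ne: "I \<noteq> {}" using \<theta> by auto
    have "exp (\<Sum>i\<in>I. \<theta> i *\<^sub>R ln (u i)) \<le> (\<Sum>i\<in>I. \<theta> i * exp (ln (u i)))"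
      using I ne \<theta> by (intro convex_on_sum[OF _ _ exp_convex]) (auto intro: less_imp_le)
    also have "exp (\<Sum>i\<in>I. \<theta> i *\<^sub>R ln (u i)) = (\<Prod>i\<in>I. u i powr \<theta> i)"
      using I u by (auto simp: exp_sum powr_def intro!: prod.cong dest: u(2))
    also have "(\<Sum>i\<in>I. \<theta> i * exp (ln (u i))) = (\<Sum>i\<in>I. \<theta> i * u i)"
      using u by (intro sum.cong) auto
    finally have "ennreal (\<Prod>i\<in>I. u i powr \<theta> i) \<le> ennreal (\<Sum>i\<in>I. \<theta> i * u i)"
      by (rule ennreal_leI)
    moreover have "(\<Prod>i\<in>I. x i epowr \<theta> i) = ennreal (\<Prod>i\<in>I. u i powr \<theta> i)"
      using u by (subst prod_ennreal[symmetric]) (auto simp: epowr_ennreal_pos)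
    moreover have "(\<Sum>i\<in>I. ennreal (\<theta> i) * x i) = ennreal (\<Sum>i\<in>I. \<theta> i * u i)"
      using u \<theta> by (subst sum_ennreal[symmetric])
        (auto simp: ennreal_mult less_imp_le intro!: sum.cong mult_nonneg_nonneg)
    ultimately show ?thesis by simp
  qed
qed

text \<open>
  After division by their integrals the functions have integral \<open>1\<close>, and the integral of the
  pointwise arithmetic-geometric mean inequality is the claim. The degenerate cases are an integral
  \<open>0\<close>, where the product vanishes almost everywhere, and an integral \<open>\<infinity>\<close> with no integral \<open>0\<close>,
  where the right-hand side is \<open>\<infinity>\<close>.
\<close>
lemma nn_integral_Holder:
  fixes X :: "'i \<Rightarrow> 'a \<Rightarrow> ennreal" and \<theta> :: "'i \<Rightarrow> real"
  assumes I: "finite I" and \<theta>: "\<And>i. i \<in> I \<Longrightarrow> 0 < \<theta> i" "(\<Sum>i\<in>I. \<theta> i) = 1"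
    and meas [measurable]: "\<And>i. i \<in> I \<Longrightarrow> X i \<in> borel_measurable M"
  shows "(\<integral>\<^sup>+x. (\<Prod>i\<in>I. X i x epowr \<theta> i) \<partial>M) \<le> (\<Prod>i\<in>I. (\<integral>\<^sup>+x. X i x \<partial>M) epowr \<theta> i)"
proof -
  define N where "N i = (\<integral>\<^sup>+x. X i x \<partial>M)" for i
  consider "\<exists>i\<in>I. N i = 0" | "\<forall>i\<in>I. N i \<noteq> 0" "\<exists>i\<in>I. N i = top"
    | "\<forall>i\<in>I. N i \<noteq> 0 \<and> N i \<noteq> top" by blast
  then show ?thesis
  proof cases
    case 1
    then obtain i where i: "i \<in> I" "N i = 0" by blast
    then have "AE x in M. X i x = 0"
      by (simp add: N_def nn_integral_0_iff_AE)
    then have "AE x in M. (\<Prod>i\<in>I. X i x epowr \<theta> i) = 0"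
      by eventually_elim (use I i \<theta> in \<open>force intro: prod_zero\<close>)
    then have "(\<integral>\<^sup>+x. (\<Prod>i\<in>I. X i x epowr \<theta> i) \<partial>M) = 0"
      by (subst nn_integral_cong_AE[where v = "\<lambda>_. 0"]) auto
    then show ?thesis by simp
  next
    case 2
    then have "(\<Prod>i\<in>I. N i epowr \<theta> i) = top"
      using I \<theta> by (subst ennreal_prod_eq_top) (auto simp: epowr_eq_0_iff epowr_eq_top_iff)
    then show ?thesis by (simp add: N_def)
  next
    case 3
    define P where "P = (\<Prod>i\<in>I. N i epowr \<theta> i)"
    have "X i x epowr \<theta> i = N i epowr \<theta> i * (X i x / N i) epowr \<theta> i" if "i \<in> I" for i x
      using 3 that \<theta>
      by (simp add: epowr_mult[symmetric] ennreal_times_divide mult.commute[of "N i"]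
            ennreal_mult_divide_eq)
    then have "(\<integral>\<^sup>+x. (\<Prod>i\<in>I. X i x epowr \<theta> i) \<partial>M) =
        (\<integral>\<^sup>+x. P * (\<Prod>i\<in>I. (X i x / N i) epowr \<theta> i) \<partial>M)"
      by (auto simp: P_def prod.distrib[symmetric] intro!: nn_integral_cong prod.cong)
    also have "\<dots> \<le> (\<integral>\<^sup>+x. P * (\<Sum>i\<in>I. ennreal (\<theta> i) * (X i x / N i)) \<partial>M)"
      by (intro nn_integral_mono mult_left_mono weighted_AM_GM_ennreal I \<theta>) auto
    also have "\<dots> = P * (\<Sum>i\<in>I. ennreal (\<theta> i) * (N i / N i))"
      by (simp add: nn_integral_cmult nn_integral_sum nn_integral_divide N_def)
    also have "(\<Sum>i\<in>I. ennreal (\<theta> i) * (N i / N i)) = (\<Sum>i\<in>I. ennreal (\<theta> i))"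
      using 3 by (intro sum.cong) (auto simp: ennreal_divide_self less_top)
    also have "\<dots> = 1"
      using \<theta> by (subst sum_ennreal) (auto intro: less_imp_le)
    finally show ?thesis by (simp add: P_def N_def)
  qed
qed

lemma Holder_pair:
  fixes X Y :: "'a \<Rightarrow> ennreal"
  assumes "0 < \<alpha>" "0 < \<beta>" "\<alpha> + \<beta> = 1"
    and [measurable]: "X \<in> borel_measurable M" "Y \<in> borel_measurable M"
  shows "(\<integral>\<^sup>+x. X x epowr \<alpha> * Y x epowr \<beta> \<partial>M) \<le>
    (\<integral>\<^sup>+x. X x \<partial>M) epowr \<alpha> * (\<integral>\<^sup>+x. Y x \<partial>M) epowr \<beta>"
  using nn_integral_Holder[of "UNIV :: bool set" "\<lambda>b. if b then \<alpha> else \<beta>" "\<lambda>b. if b then X else Y" M]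
    assms by (simp add: UNIV_bool mult.commute add.commute)

section \<open>Comparison of superlevel sets and greedy selection\<close>

text \<open>
  Layer cake representation: by Tonelli, the integral of a function is the integral over the
  heights \<open>t \<ge> 0\<close> of the measures of its superlevel sets.
\<close>
lemma nn_integral_mono_superlevel:
  fixes X Y :: "'a \<Rightarrow> ennreal"
  assumes "sigma_finite_measure M"
    and X [measurable]: "X \<in> borel_measurable M" and Y [measurable]: "Y \<in> borel_measurable M"
    and le: "\<And>t. 0 \<le> t \<Longrightarrow> emeasure M {x \<in> space M. ennreal t < X x} \<le>
      c * emeasure M {x \<in> space M. ennreal t < Y x}"
  shows "(\<integral>\<^sup>+x. X x \<partial>M) \<le> c * (\<integral>\<^sup>+x. Y x \<partial>M)"
proof -
  interpret sigma_finite_measure M by fact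
  interpret pair_sigma_finite M "lborel :: real measure" ..
  have layers: "(\<integral>\<^sup>+x. Z x \<partial>M) =
      (\<integral>\<^sup>+t. indicator {0..} t * emeasure M {x \<in> space M. ennreal t < Z x} \<partial>lborel)"
    if [measurable]: "Z \<in> borel_measurable M" for Z :: "'a \<Rightarrow> ennreal"
  proof -
    have "Z x = (\<integral>\<^sup>+t. indicator {0..} t * indicator {t. ennreal t < Z x} t \<partial>lborel)" for x
    proof -
      have "(\<integral>\<^sup>+t. indicator {0..} t * indicator {t. ennreal t < Z x} t \<partial>lborel) =
          emeasure lborel {t::real. 0 \<le> t \<and> ennreal t < Z x}"
        by (subst nn_integral_indicator[symmetric])
           (auto simp: indicator_def simp del: nn_integral_indicator intro!: nn_integral_cong)
      also have "\<dots> = Z x"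
      proof (cases "Z x")
        case (real r)
        then have "{t::real. 0 \<le> t \<and> ennreal t < Z x} = {0..<r}"
          by (auto simp: ennreal_less_iff)
        then show ?thesis using real by simp
      next
        case top
        then have "{t::real. 0 \<le> t \<and> ennreal t < Z x} = {0..}" by auto
        moreover have "ennreal (real n) \<le> emeasure lborel {0::real..}" for n
          using emeasure_mono[of "{0..real n}" "{0..}" lborel] by simp
        then have "emeasure lborel {0::real..} = top"
          using ennreal_SUP_of_nat_eq_top
          by (metis SUP_least ennreal_of_nat_eq_real_of_nat top_unique)
        ultimately show ?thesis using top by simp
      qed
      finally show ?thesis by simp
    qed
    then have "(\<integral>\<^sup>+x. Z x \<partial>M) =
        (\<integral>\<^sup>+x. (\<integral>\<^sup>+t. indicator {0..} t * indicator {t. ennreal t < Z x} t \<partial>lborel) \<partial>M)"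
      by simp
    also have "\<dots> = (\<integral>\<^sup>+t. (\<integral>\<^sup>+x. indicator {0..} t * indicator {t. ennreal t < Z x} t \<partial>M) \<partial>lborel)"
      by (rule Fubini'[symmetric]) measurable
    also have "\<dots> = (\<integral>\<^sup>+t. indicator {0..} t * emeasure M {x \<in> space M. ennreal t < Z x} \<partial>lborel)"
      by (auto intro!: nn_integral_cong simp: nn_integral_cmult[symmetric]
            nn_integral_indicator[symmetric] indicator_def simp del: nn_integral_indicator)
    finally show ?thesis .
  qed
  have "(\<integral>\<^sup>+x. X x \<partial>M) \<le>
      (\<integral>\<^sup>+t. c * (indicator {0..} t * emeasure M {x \<in> space M. ennreal t < Y x}) \<partial>lborel)"
    unfolding layers[OF X] by (intro nn_integral_mono) (auto simp: le indicator_def)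
  also have "\<dots> = c * (\<integral>\<^sup>+x. Y x \<partial>M)"
    unfolding layers[OF Y] by (rule nn_integral_cmult) measurable
  finally show ?thesis .
qed

text \<open>
  A Cordoba-Fefferman selection. The sets are treated in the order of decreasing \<open>a\<close>, and a set is
  selected if at most the fraction \<open>l\<close> of its measure lies in the sets selected earlier. Removing the
  latter from it leaves the pairwise disjoint parts \<open>E B\<close>, each at least the fraction \<open>1 - l\<close> of
  \<open>B\<close>. If a set is omitted, more than the fraction \<open>l\<close> of it lies in selected sets, all with a
  value of \<open>a\<close> at least as large as its own; a selected set is covered by itself. Keeping track
  of \<open>a\<close> in this way makes one selection serve all superlevel sets of \<open>a\<close> at once.
\<close>
lemma greedy_selection:
  fixes a :: "'a set \<Rightarrow> ennreal"
  assumes "finite F" and F: "\<And>B. B \<in> F \<Longrightarrow> B \<in> sets M"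
      "\<And>B. B \<in> F \<Longrightarrow> 0 < measure M B" "\<And>B. B \<in> F \<Longrightarrow> emeasure M B < \<infinity>"
    and l: "0 < l" "l < 1"
  obtains S E where "S \<subseteq> F" "disjoint_family_on E S"
    "\<And>B. B \<in> S \<Longrightarrow> E B \<in> sets M \<and> E B \<subseteq> B \<and> (1 - l) * measure M B \<le> measure M (E B)"
    "\<And>B. B \<in> F \<Longrightarrow> l * measure M B < measure M (B \<inter> \<Union>{A \<in> S. a B \<le> a A})"
proof -
  let ?P = "\<lambda>F S E. S \<subseteq> F \<and> disjoint_family_on E S \<and>
    (\<forall>B\<in>S. E B \<in> sets M \<and> E B \<subseteq> B \<and> (1 - l) * measure M B \<le> measure M (E B)) \<and>
    (\<forall>B\<in>F. l * measure M B < measure M (B \<inter> \<Union>{A \<in> S. a B \<le> a A}))"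
  have "\<exists>S E. ?P F S E"
    using assms(1)
  proof (induction rule: finite_remove_induct)
    case empty
    then show ?case by (auto simp: disjoint_family_on_def)
  next
    case (remove G)
    \<comment> \<open>The least value of \<open>a\<close> is treated last, after the selection from the other sets.\<close>
    obtain x where x: "x \<in> G" and amin: "\<And>y. y \<in> G \<Longrightarrow> a x \<le> a y"
      using ex_min_if_finite[of "a ` G"] remove(1,2) by (auto simp: not_less)
    from remove(4)[OF x] obtain S E where P: "?P (G - {x}) S E" by blast
    have xF: "x \<in> sets M" "0 < measure M x" "x \<in> fmeasurable M"
      using x remove(3) F by (auto simp: fmeasurable_def)
    have S: "S \<subseteq> G - {x}" "finite S" "{A \<in> S. a x \<le> a A} = S"
      using P remove(1) amin by (auto intro: finite_subset)
    moreover have "\<Union>S \<in> sets M"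
      using S(1,2) remove(3) F(1) by (intro sets.finite_Union) auto
    ultimately have S: "S \<subseteq> G - {x}" "finite S" "{A \<in> S. a x \<le> a A} = S" "\<Union>S \<in> sets M"
      by auto
    show ?case
    proof (cases "l * measure M x < measure M (x \<inter> \<Union>S)")
      case True
      then have "?P G S E" using P S(3) by auto
      then show ?thesis by blast
    next
      case False
      define E' where "E' = E(x := x - \<Union>S)"
      have [simp]: "E' A = E A" if "A \<in> S" for A
        using that S(1) by (auto simp: E'_def)
      have E'x: "E' x = x - \<Union>S" by (simp add: E'_def)
      have "measure M (x - \<Union>S) = measure M x - measure M (x \<inter> \<Union>S)"
        using xF S(4) measure_Diff[of M x "x \<inter> \<Union>S"] sets.Int[OF xF(1) S(4)]
        by (simp add: fmeasurable_def Diff_Int less_top)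
      then have big: "(1 - l) * measure M x \<le> measure M (E' x)"
        using False by (simp add: E'x algebra_simps)
      have disj: "disjoint_family_on E' (insert x S)"
      proof -
        have "E' x \<inter> E' A = {}" if "A \<in> S" for A
          using that P E'x by simp blast
        then show ?thesis
          using P S(1) unfolding disjoint_family_on_def by (metis Int_commute insert_iff \<open>\<And>A. A \<in> S \<Longrightarrow> E' A = E A\<close>)
      qed
      have sel: "l * measure M B < measure M (B \<inter> \<Union>{A \<in> insert x S. a B \<le> a A})" if "B \<in> G" for B
      proof (cases "B = x")
        case True
        then have "B \<inter> \<Union>{A \<in> insert x S. a B \<le> a A} = x" by auto
        then show ?thesis using True xF l by simp
      next
        case False
        have BF: "B \<in> F" using that remove(3) by blast
        have "l * measure M B < measure M (B \<inter> \<Union>{A \<in> S. a B \<le> a A})"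
          using P that False by simp
        also have "\<dots> \<le> measure M (B \<inter> \<Union>{A \<in> insert x S. a B \<le> a A})"
        proof (rule measure_mono_fmeasurable)
          show "B \<inter> \<Union>{A \<in> S. a B \<le> a A} \<in> sets M"
            using S F(1) remove(3) that by (intro sets.Int sets.finite_Union) auto
          have "B \<inter> \<Union>{A \<in> insert x S. a B \<le> a A} \<in> sets M"
            using S F(1) remove(3) that x by (intro sets.Int sets.finite_Union) auto
          then show "B \<inter> \<Union>{A \<in> insert x S. a B \<le> a A} \<in> fmeasurable M"
            by (rule fmeasurableI2[OF fmeasurableI[OF F(1)[OF BF] F(3)[OF BF]] Int_lower1])
        qed auto
        finally show ?thesis .
      qed
      have "?P G (insert x S) E'"
      proof (intro conjI ballI)
        fix B assume "B \<in> insert x S"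
        then consider "B = x" | "B \<in> S" by blast
        then show "E' B \<in> sets M" "E' B \<subseteq> B" "(1 - l) * measure M B \<le> measure M (E' B)"
          by (cases; use P S(4) xF(1) big in \<open>simp add: E'x\<close>; blast)+
      qed (use S(1) x disj sel in auto)
      then show ?thesis by blast
    qed
  qed
  then show ?thesis using that by blast
qed

section \<open>Suprema over the members of a basis\<close>

text \<open>
  This is the common shape of all maximal functions below: the maximal function of \<open>h\<close> and the
  powers of the multilinear one arise from different functions \<open>a\<close>, and restricting the family
  \<open>\<B>\<close> gives their truncations.
\<close>
definition basis_sup :: "'a set set \<Rightarrow> ('a set \<Rightarrow> ennreal) \<Rightarrow> 'a \<Rightarrow> ennreal" where
  "basis_sup \<B> a x = (SUP B\<in>{B\<in>\<B>. x \<in> B}. a B)"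

lemma superlevel_basis_sup: "{x. t < basis_sup \<B> a x} = \<Union>{B \<in> \<B>. t < a B}"
  by (auto simp: basis_sup_def less_SUP_iff)

lemma maximal_eq_basis_sup: "maximal \<B> h = basis_sup \<B> (\<lambda>B. avg B (\<lambda>y. ennreal \<bar>h y\<bar>))"
  by (simp add: fun_eq_iff maximal_def basis_sup_def)

lemma borel_measurable_basis_sup:
  assumes "\<And>B. B \<in> \<B> \<Longrightarrow> open B"
  shows "basis_sup \<B> a \<in> borel_measurable lebesgue"
proof (rule borel_measurableI_greater)
  fix t
  have "open {x. t < basis_sup \<B> a x}"
    unfolding superlevel_basis_sup using assms by (intro open_Union) auto
  then show "{x \<in> space lebesgue. t < basis_sup \<B> a x} \<in> sets lebesgue"
    by simp
qed

text \<open>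
  By Lindelof, countably many members already cover each superlevel set at a rational height, and
  a supremum is determined by its superlevel sets at rational heights.
\<close>
lemma basis_sup_countable:
  fixes \<B> :: "'a::second_countable_topology set set"
  assumes "\<And>B. B \<in> \<B> \<Longrightarrow> open B"
  obtains \<C> where "countable \<C>" "\<C> \<subseteq> \<B>" "basis_sup \<C> a = basis_sup \<B> a"
proof -
  have "\<exists>\<C>. countable \<C> \<and> \<C> \<subseteq> {B\<in>\<B>. ennreal (of_rat q) < a B} \<and>
      \<Union>\<C> = \<Union>{B\<in>\<B>. ennreal (of_rat q) < a B}" for q :: rat
    using Lindelof[of "{B\<in>\<B>. ennreal (of_rat q) < a B}"] assms by (metis (lifting) mem_Collect_eq)
  then obtain C where C: "\<And>q::rat. countable (C q)"
      "\<And>q. C q \<subseteq> {B\<in>\<B>. ennreal (of_rat q) < a B}"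
      "\<And>q. \<Union>(C q) = \<Union>{B\<in>\<B>. ennreal (of_rat q) < a B}"
    by metis
  let ?C = "\<Union>q. C q"
  have sub: "?C \<subseteq> \<B>" using C(2) by auto
  have "basis_sup ?C a x = basis_sup \<B> a x" for x
  proof (rule antisym)
    show "basis_sup ?C a x \<le> basis_sup \<B> a x"
      unfolding basis_sup_def using sub by (intro SUP_subset_mono) auto
    show "basis_sup \<B> a x \<le> basis_sup ?C a x"
    proof (rule ccontr)
      assume "\<not> ?thesis"
      then obtain q :: rat where q: "basis_sup ?C a x < of_rat q" "ennreal (of_rat q) < basis_sup \<B> a x"
        using ennreal_rat_dense[of "basis_sup ?C a x" "basis_sup \<B> a x"] by (auto simp: not_le)
      then have "x \<in> \<Union>(C q)"
        using C(3)[of q] superlevel_basis_sup[of "ennreal (of_rat q)" \<B> a] by auto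
      then obtain B where B: "B \<in> C q" "x \<in> B" by blast
      then have "a B \<le> basis_sup ?C a x"
        unfolding basis_sup_def by (intro SUP_upper) auto
      moreover have "ennreal (of_rat q) < a B" using B C(2) by auto
      ultimately show False using q by auto
    qed
  qed
  then show ?thesis
    using that[of ?C] sub C(1) by (auto simp: fun_eq_iff)
qed

text \<open>
  The supremum over an uncountable basis is replaced by one over a countable subfamily, and
  this is the increasing limit of suprema over finite families.
\<close>
lemma nn_integral_basis_sup_le:
  fixes \<B> :: "(real ^ 'n) set set"
  assumes op: "\<And>B. B \<in> \<B> \<Longrightarrow> open B" and sets: "sets N = sets lebesgue"
    and fin: "\<And>F. finite F \<Longrightarrow> F \<subseteq> \<B> \<Longrightarrow> (\<integral>\<^sup>+x. basis_sup F a x \<partial>N) \<le> K"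
  shows "(\<integral>\<^sup>+x. basis_sup \<B> a x \<partial>N) \<le> K"
proof -
  obtain \<C> where \<C>: "countable \<C>" "\<C> \<subseteq> \<B>" "basis_sup \<C> a = basis_sup \<B> a"
    using basis_sup_countable[OF op] by metis
  show ?thesis
  proof (cases "\<C> = {}")
    case True
    then show ?thesis using \<C>(3) fin[of "{}"] by simp
  next
    case False
    define F where "F n = from_nat_into \<C> ` {..n}" for n :: nat
    have F: "finite (F n)" "F n \<subseteq> \<B>" for n
      using False \<C>(2) from_nat_into[OF False] by (auto simp: F_def)
    have mF: "basis_sup (F n) a \<in> borel_measurable N" for n
      using borel_measurable_basis_sup[of "F n" a] F(2)[of n] op
      by (auto simp: measurable_cong_sets[OF sets refl])
    have "basis_sup \<C> a x = (SUP n. basis_sup (F n) a x)" for x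
    proof (rule antisym)
      show "basis_sup \<C> a x \<le> (SUP n. basis_sup (F n) a x)"
        unfolding basis_sup_def[of \<C>]
      proof (rule SUP_least)
        fix B assume B: "B \<in> {B \<in> \<C>. x \<in> B}"
        then obtain n where "from_nat_into \<C> n = B"
          using from_nat_into_surj[OF \<C>(1)] by blast
        then have "a B \<le> basis_sup (F n) a x"
          using B unfolding basis_sup_def by (intro SUP_upper) (auto simp: F_def)
        then show "a B \<le> (SUP n. basis_sup (F n) a x)"
          by (rule order_trans) (auto intro: SUP_upper)
      qed
      show "(SUP n. basis_sup (F n) a x) \<le> basis_sup \<C> a x"
        unfolding basis_sup_def using from_nat_into[OF False]
        by (intro SUP_least SUP_subset_mono) (auto simp: F_def intro!: SUP_upper)
    qed
    then have "(\<integral>\<^sup>+x. basis_sup \<B> a x \<partial>N) = (\<integral>\<^sup>+x. (SUP n. basis_sup (F n) a x) \<partial>N)"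
      by (simp add: \<C>(3)[symmetric])
    also have "\<dots> = (SUP n. \<integral>\<^sup>+x. basis_sup (F n) a x \<partial>N)"
    proof (rule nn_integral_monotone_convergence_SUP)
      show "incseq (\<lambda>n. basis_sup (F n) a)"
        unfolding incseq_def le_fun_def basis_sup_def F_def
        by (intro allI impI SUP_subset_mono) auto
    qed (rule mF)
    also have "\<dots> \<le> K" using fin[OF F] by (intro SUP_least) simp
    finally show ?thesis .
  qed
qed

section \<open>Covering argument for weights satisfying condition (A)\<close>

lemma sets_weighted [simp]: "sets (weighted w) = sets lebesgue"
  and space_weighted [simp]: "space (weighted w) = UNIV"
  by (auto simp: weighted_def)

lemma sigma_finite_weighted:
  fixes w :: "real ^ 'n \<Rightarrow> real"
  assumes "w \<in> borel_measurable lebesgue"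
  shows "sigma_finite_measure (weighted w)"
proof -
  obtain A where A: "countable A" "A \<subseteq> sets lborel" "\<Union>A = UNIV"
      "\<forall>a\<in>A. emeasure (lborel :: (real ^ 'n) measure) a \<noteq> \<infinity>"
    using lborel.sigma_finite_countable by auto
  have "sigma_finite_measure (lebesgue :: (real ^ 'n) measure)"
    by (rule sigma_finite_measure.intro, intro exI[of _ A]) (use A in auto)
  then show ?thesis
    unfolding weighted_def using assms
    by (subst sigma_finite_measure.sigma_finite_iff_density_finite) auto
qed

lemma basis_setD:
  assumes "is_basis \<B>" "B \<in> \<B>"
  shows "open B" "B \<in> sets lebesgue" "emeasure lebesgue B = ennreal (measure lebesgue B)"
    "0 < measure lebesgue B" "emeasure lebesgue B \<noteq> 0" "emeasure lebesgue B < \<infinity>"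
proof -
  show op: "open B" "B \<in> sets lebesgue" and fin: "emeasure lebesgue B < \<infinity>"
    using assms by (auto simp: is_basis_def)
  show eq: "emeasure lebesgue B = ennreal (measure lebesgue B)"
    using fin by (simp add: emeasure_eq_ennreal_measure less_top)
  show ne: "emeasure lebesgue B \<noteq> 0"
    using op assms open_not_negligible[of B]
    by (auto simp: is_basis_def negligible_iff_null_sets null_sets_def)
  then show "0 < measure lebesgue B" unfolding eq by (simp add: less_le)
qed

text \<open>
  Let \<open>S\<^sub>t\<close> consist of the selected sets with value above \<open>t\<close>, and let \<open>U\<close> be its union. Every
  member of \<open>F\<close> with value above \<open>t\<close> has more than the fraction \<open>l\<close> of its measure in \<open>U\<close>, so the
  superlevel set of the supremum over \<open>F\<close> lies in the set where the maximal function of the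
  indicator of \<open>U\<close> exceeds \<open>l\<close>. Condition (A) bounds the weight of this set by that of \<open>U\<close>, which is
  the superlevel set of the supremum over \<open>S\<close>. This being so at all heights \<open>t\<close> simultaneously,
  the integrals compare, and the supremum over \<open>S\<close> is at most the sum over \<open>S\<close>.
\<close>
lemma covering_bound:
  fixes \<B> :: "(real ^ 'n) set set" and \<nu> :: "real ^ 'n \<Rightarrow> real"
  assumes \<B>: "is_basis \<B>" and \<nu>: "is_weight \<B> \<nu>" and l: "0 < l" "l < 1"
    and A: "\<And>E. E \<in> sets lebesgue \<Longrightarrow>
      emeasure (weighted \<nu>) {x. ennreal l < maximal \<B> (indicat_real E) x} \<le>
        c * emeasure (weighted \<nu>) E"
    and F: "finite F" "F \<subseteq> \<B>"
  obtains S E where "S \<subseteq> F" "disjoint_family_on E S"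
    "\<And>B. B \<in> S \<Longrightarrow> E B \<in> sets lebesgue \<and> E B \<subseteq> B \<and>
       emeasure lebesgue B \<le> ennreal (1 / (1 - l)) * emeasure lebesgue (E B)"
    "(\<integral>\<^sup>+x. basis_sup F a x \<partial>weighted \<nu>) \<le> c * (\<Sum>B\<in>S. a B * emeasure (weighted \<nu>) B)"
proof -
  note b = basis_setD[OF \<B>]
  have \<nu>m: "\<nu> \<in> borel_measurable lebesgue" using \<nu> by (simp add: is_weight_def)
  obtain S E where S: "S \<subseteq> F" "disjoint_family_on E S"
    and E: "\<And>B. B \<in> S \<Longrightarrow> E B \<in> sets lebesgue \<and> E B \<subseteq> B \<and>
         (1 - l) * measure lebesgue B \<le> measure lebesgue (E B)"
    and sel: "\<And>B. B \<in> F \<Longrightarrow>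
      l * measure lebesgue B < measure lebesgue (B \<inter> \<Union>{A \<in> S. a B \<le> a A})"
    by (rule greedy_selection[of F lebesgue l a]) (use F b l in \<open>auto 0 3\<close>)
  have opF: "open B" if "B \<in> F" for B using that F b by auto
  have finS: "finite S" using S(1) F(1) by (rule finite_subset)
  have meas: "basis_sup G a \<in> borel_measurable (weighted \<nu>)" if "G \<subseteq> F" for G
    using borel_measurable_basis_sup[of G a] opF that
    by (auto simp: measurable_cong_sets[OF sets_weighted refl])
  have big: "emeasure lebesgue B \<le> ennreal (1 / (1 - l)) * emeasure lebesgue (E B)" if "B \<in> S" for B
  proof -
    have B: "B \<in> \<B>" using that S F by auto
    have "measure lebesgue B \<le> 1 / (1 - l) * measure lebesgue (E B)"
      using E[OF that] l by (simp add: field_simps)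
    moreover have "emeasure lebesgue (E B) \<noteq> \<infinity>"
      using emeasure_mono[of "E B" B lebesgue] E[OF that] b[OF B] by (auto simp: top_unique)
    ultimately show ?thesis
      using l b(3)[OF B]
      by (simp add: emeasure_eq_ennreal_measure ennreal_mult[symmetric] ennreal_leI)
  qed
  have "(\<integral>\<^sup>+x. basis_sup F a x \<partial>weighted \<nu>) \<le> c * (\<integral>\<^sup>+x. basis_sup S a x \<partial>weighted \<nu>)"
  proof (rule nn_integral_mono_superlevel[OF sigma_finite_weighted[OF \<nu>m] meas meas])
    fix t :: real assume "0 \<le> t"
    define U where "U = \<Union>{A \<in> S. ennreal t < a A}"
    have "open U"
      unfolding U_def using S(1) opF by (intro open_Union) auto
    then have U: "U \<in> sets lebesgue" by simp
    have "{x. ennreal t < basis_sup F a x} \<subseteq> {x. ennreal l < maximal \<B> (indicat_real U) x}"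
      unfolding superlevel_basis_sup
    proof safe
      fix x B assume x: "x \<in> B" and B: "B \<in> F" "ennreal t < a B"
      have B\<B>: "B \<in> \<B>" using B F by auto
      have "l * measure lebesgue B < measure lebesgue (B \<inter> \<Union>{A \<in> S. a B \<le> a A})"
        using sel[OF B(1)] .
      also have "\<dots> \<le> measure lebesgue (B \<inter> U)"
      proof (rule measure_mono_fmeasurable)
        show "B \<inter> \<Union>{A \<in> S. a B \<le> a A} \<subseteq> B \<inter> U"
          using B(2) by (auto simp: U_def)
        have "open (B \<inter> \<Union>{A \<in> S. a B \<le> a A})"
          using B S opF by (intro open_Int open_Union) auto
        then show "B \<inter> \<Union>{A \<in> S. a B \<le> a A} \<in> sets lebesgue" by simp
        show "B \<inter> U \<in> fmeasurable lebesgue"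
          using U b(2,6)[OF B\<B>] by (intro fmeasurable_Int_fmeasurable fmeasurableI) auto
      qed
      finally have "l < measure lebesgue (B \<inter> U) / measure lebesgue B"
        using b(4)[OF B\<B>] by (simp add: field_simps)
      then have "ennreal l < ennreal (measure lebesgue (B \<inter> U)) / ennreal (measure lebesgue B)"
        using l b(4)[OF B\<B>] by (simp add: divide_ennreal ennreal_lessI)
      also have "\<dots> = emeasure lebesgue (B \<inter> U) / emeasure lebesgue B"
      proof -
        have "emeasure lebesgue (B \<inter> U) \<le> emeasure lebesgue B"
          by (rule emeasure_mono[OF Int_lower1 b(2)[OF B\<B>]])
        then have "emeasure lebesgue (B \<inter> U) \<noteq> \<infinity>"
          using b(6)[OF B\<B>] by (auto simp: top_unique)
        then show ?thesis
          using b(3)[OF B\<B>] by (simp add: emeasure_eq_ennreal_measure)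
      qed
      also have "\<dots> = avg B (\<lambda>y. ennreal \<bar>indicat_real U y\<bar>)"
      proof -
        have "(\<integral>\<^sup>+y\<in>B. ennreal \<bar>indicat_real U y\<bar> \<partial>lebesgue) = (\<integral>\<^sup>+y. indicator (B \<inter> U) y \<partial>lebesgue)"
          by (intro nn_integral_cong) (auto simp: indicator_def)
        then show ?thesis unfolding avg_def using U b(2)[OF B\<B>] by simp
      qed
      also have "\<dots> \<le> maximal \<B> (indicat_real U) x"
        unfolding maximal_def using x B\<B> by (intro SUP_upper) auto
      finally show "ennreal l < maximal \<B> (indicat_real U) x" .
    qed
    moreover have "{x. ennreal l < maximal \<B> (indicat_real U) x} \<in> sets lebesgue"
    proof -
      have "maximal \<B> (indicat_real U) = basis_sup \<B> (\<lambda>B. avg B (\<lambda>y. ennreal \<bar>indicat_real U y\<bar>))"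
        by (simp add: fun_eq_iff maximal_def basis_sup_def)
      moreover have "open {x. ennreal l < basis_sup \<B> a' x}" for a'
        unfolding superlevel_basis_sup using b(1) by (intro open_Union) simp
      ultimately show ?thesis by simp
    qed
    ultimately have "emeasure (weighted \<nu>) {x. ennreal t < basis_sup F a x} \<le>
        emeasure (weighted \<nu>) {x. ennreal l < maximal \<B> (indicat_real U) x}"
      by (intro emeasure_mono) simp_all
    also have "\<dots> \<le> c * emeasure (weighted \<nu>) U" by (rule A[OF U])
    finally show "emeasure (weighted \<nu>) {x \<in> space (weighted \<nu>). ennreal t < basis_sup F a x} \<le>
        c * emeasure (weighted \<nu>) {x \<in> space (weighted \<nu>). ennreal t < basis_sup S a x}"
      by (simp add: U_def superlevel_basis_sup)
  qed (simp_all add: S(1))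
  also have "(\<integral>\<^sup>+x. basis_sup S a x \<partial>weighted \<nu>) \<le>
      (\<integral>\<^sup>+x. (\<Sum>B\<in>S. a B * indicator B x) \<partial>weighted \<nu>)"
    unfolding basis_sup_def
  proof (intro nn_integral_mono SUP_least)
    fix x B assume "B \<in> {B \<in> S. x \<in> B}"
    then show "a B \<le> (\<Sum>B\<in>S. a B * indicator B x)"
      using member_le_sum[of B S "\<lambda>B. a B * indicator B x"] finS by simp
  qed
  also have "(\<integral>\<^sup>+x. (\<Sum>B\<in>S. a B * indicator B x) \<partial>weighted \<nu>) =
      (\<Sum>B\<in>S. a B * emeasure (weighted \<nu>) B)"
  proof -
    have S_sets: "B \<in> sets (weighted \<nu>)" if "B \<in> S" for B
      using that S(1) opF by auto
    then have "(\<integral>\<^sup>+x. (\<Sum>B\<in>S. a B * indicator B x) \<partial>weighted \<nu>) =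
        (\<Sum>B\<in>S. \<integral>\<^sup>+x. a B * indicator B x \<partial>weighted \<nu>)"
      by (intro nn_integral_sum) (auto simp del: sets_weighted)
    then show ?thesis
      using S_sets by (simp add: nn_integral_cmult_indicator)
  qed
  finally have "(\<integral>\<^sup>+x. basis_sup F a x \<partial>weighted \<nu>) \<le>
      c * (\<Sum>B\<in>S. a B * emeasure (weighted \<nu>) B)"
    by (simp add: mult_left_mono)
  then show ?thesis using that[OF S] E big by blast
qed

section \<open>Bumped averages\<close>

text \<open>
  The exponent \<open>(q' r)'\<close> dual to the bumped exponent \<open>q' r\<close> of the weight. Since \<open>q' r > q'\<close>, it is
  smaller than \<open>q\<close>, and this gap is where the bump enters: it leaves room for the maximal
  operator to be bounded on \<open>L\<^sup>q\<^sup>/\<^sup>s\<close> with \<open>s = (q' r)'\<close>.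
\<close>
definition bump_exp :: "real \<Rightarrow> real \<Rightarrow> real" where
  "bump_exp q r = conj_exp (conj_exp q * r)"

text \<open>
  The factor \<open>w\<^sup>1\<^sup>/\<^sup>q\<close> turns the norm of \<open>f\<close> in \<open>L\<^sup>q(w)\<close> into an unweighted one; the outer power
  makes the average of order \<open>(q' r)'\<close> an ordinary average, to which the maximal operator applies.
\<close>
definition bumped :: "real \<Rightarrow> real \<Rightarrow> (real ^ 'n \<Rightarrow> real) \<Rightarrow> (real ^ 'n \<Rightarrow> real) \<Rightarrow> real ^ 'n \<Rightarrow> real" where
  "bumped q r w f x = (\<bar>f x\<bar> * w x powr (1 / q)) powr bump_exp q r"

lemma conj_exp_gt_1: "1 < q \<Longrightarrow> 1 < conj_exp q"
  by (simp add: conj_exp_def)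

lemma inverse_conj_exp: "1 < q \<Longrightarrow> 1 / conj_exp q = 1 - 1 / q"
  by (simp add: conj_exp_def field_simps)

lemma bump_exp_bounds:
  assumes "1 < q" "1 < r"
  shows "1 < bump_exp q r" "bump_exp q r < q"
proof -
  let ?t = "conj_exp q * r"
  have q': "1 < conj_exp q" using assms(1) by (rule conj_exp_gt_1)
  have t: "conj_exp q < ?t" using q' assms(2) by simp
  then show s: "1 < bump_exp q r"
    unfolding bump_exp_def using q' by (intro conj_exp_gt_1) linarith
  have "1 / q = 1 - 1 / conj_exp q" using inverse_conj_exp[OF assms(1)] by simp
  also have "\<dots> < 1 - 1 / ?t" using t q' by (simp add: frac_less2)
  also have "\<dots> = 1 / bump_exp q r"
    unfolding bump_exp_def using t q' by (intro inverse_conj_exp[symmetric]) linarith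
  finally show "bump_exp q r < q" using s assms by (simp add: field_simps)
qed

lemma borel_measurable_bumped:
  assumes [measurable]: "f \<in> borel_measurable lebesgue" "w \<in> borel_measurable lebesgue"
  shows "bumped q r w f \<in> borel_measurable lebesgue"
  unfolding bumped_def by measurable

lemma avg_eq_nn_integral_uniform_measure:
  assumes "B \<in> sets lebesgue" "g \<in> borel_measurable lebesgue"
  shows "avg B g = (\<integral>\<^sup>+x. g x \<partial>uniform_measure lebesgue B)"
  using assms by (simp add: avg_def nn_integral_uniform_measure)

text \<open>
  Averages of negative powers of a finite weight never vanish; hence a factor \<open>\<infinity>\<close> in the bump
  condition cannot be hidden by a factor \<open>0\<close> coming from another \<open>w\<^sub>j\<close>.
\<close>
lemma avg_neq_0:
  assumes "is_basis \<B>" "B \<in> \<B>" "g \<in> borel_measurable lebesgue" and pos: "\<And>x. g x \<noteq> 0"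
  shows "avg B g \<noteq> 0"
proof
  assume "avg B g = 0"
  note b = basis_setD[OF assms(1,2)]
  have "AE x in uniform_measure lebesgue B. g x = 0"
    using assms b \<open>avg B g = 0\<close> by (subst nn_integral_0_iff_AE[symmetric])
      (auto simp: avg_eq_nn_integral_uniform_measure)
  then have "emeasure (uniform_measure lebesgue B) (space lebesgue) = 0"
    using pos by (simp add: eventually_False ae_filter_eq_bot_iff)
  then show False
    using b by (simp add: emeasure_uniform_measure ennreal_divide_self)
qed

text \<open>
  Hoelder's inequality with the exponents \<open>s = (q' r)'\<close> and \<open>q' r\<close>, applied to the product of
  \<open>|f| w powr (1 / q)\<close> and \<open>w powr (- 1 / q)\<close>; the latter is the power \<open>1 / (q' r)\<close> of
  \<open>w powr ((1 - q') r)\<close>. The product fails to be \<open>|f|\<close> where \<open>w = 0\<close>, but the finite average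
  makes this a null set in \<open>B\<close>.
\<close>
lemma avg_le_bump:
  fixes f w :: "real ^ 'n \<Rightarrow> real"
  assumes B: "is_basis \<B>" "B \<in> \<B>"
    and f [measurable]: "f \<in> borel_measurable lebesgue"
    and w [measurable]: "w \<in> borel_measurable lebesgue" and w0: "\<And>x. 0 \<le> w x"
    and q: "1 < q" and r: "1 < r"
    and fin: "avg B (\<lambda>x. ennreal (w x) epowr ((1 - conj_exp q) * r)) < \<infinity>"
  shows "avg B (\<lambda>x. ennreal \<bar>f x\<bar>) \<le>
    avg B (\<lambda>x. ennreal \<bar>bumped q r w f x\<bar>) epowr (1 / bump_exp q r) *
    avg B (\<lambda>x. ennreal (w x) epowr ((1 - conj_exp q) * r)) epowr (1 / (conj_exp q * r))"
proof -
  note b = basis_setD[OF B]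
  note [measurable] = borel_measurable_bumped[OF f w]
  let ?N = "uniform_measure lebesgue B"
  let ?W = "\<lambda>x. ennreal (w x) epowr ((1 - conj_exp q) * r)"
  let ?H = "\<lambda>x. ennreal \<bar>bumped q r w f x\<bar>"
  define s where "s = bump_exp q r"
  define \<tau> where "\<tau> = conj_exp q * r"
  have q': "1 < conj_exp q" using q by (rule conj_exp_gt_1)
  have \<tau>: "1 < \<tau>" using q' r unfolding \<tau>_def by (simp add: less_1_mult)
  have s: "1 < s" "1 / s = 1 - 1 / \<tau>"
    using conj_exp_gt_1[OF \<tau>] inverse_conj_exp[OF \<tau>] by (auto simp: s_def \<tau>_def bump_exp_def)
  have neg: "(1 - conj_exp q) * r < 0" using q' r by (simp add: mult_less_0_iff)
  have ex: "(1 - conj_exp q) * r * (1 / \<tau>) = - (1 / q)"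
  proof -
    have "(1 - conj_exp q) * r * (1 / \<tau>) = 1 / conj_exp q - 1"
      using q' r by (simp add: \<tau>_def field_simps)
    then show ?thesis using inverse_conj_exp[OF q] by simp
  qed
  note av = avg_eq_nn_integral_uniform_measure[OF b(2)]
  have "AE x in ?N. ?W x \<noteq> \<infinity>"
    using fin by (intro nn_integral_PInf_AE) (auto simp: av less_top)
  then have "AE x in ?N. ennreal \<bar>f x\<bar> = ?H x epowr (1 / s) * ?W x epowr (1 / \<tau>)"
  proof eventually_elim
    case (elim x)
    have "w x \<noteq> 0" using elim neg by (auto simp: epowr_zero_neg)
    then have wx: "0 < w x" using w0[of x] by simp
    have "?H x epowr (1 / s) = ennreal (\<bar>f x\<bar> * w x powr (1 / q))"
      using s(1) by (simp add: epowr_ennreal powr_powr bumped_def s_def)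
    moreover have "?W x epowr (1 / \<tau>) = ennreal (w x powr (- (1 / q)))"
      using wx \<tau> ex by (simp add: epowr_ennreal_pos powr_powr)
    moreover have "\<bar>f x\<bar> = (\<bar>f x\<bar> * w x powr (1 / q)) * w x powr (- (1 / q))"
      using wx by (simp add: powr_minus)
    ultimately show ?case by (simp add: ennreal_mult[symmetric])
  qed
  then have "avg B (\<lambda>x. ennreal \<bar>f x\<bar>) = (\<integral>\<^sup>+x. ?H x epowr (1 / s) * ?W x epowr (1 / \<tau>) \<partial>?N)"
    by (subst av) (auto intro: nn_integral_cong_AE)
  also have "\<dots> \<le> (\<integral>\<^sup>+x. ?H x \<partial>?N) epowr (1 / s) * (\<integral>\<^sup>+x. ?W x \<partial>?N) epowr (1 / \<tau>)"
    using s \<tau> by (intro Holder_pair) auto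
  finally show ?thesis by (simp add: av \<tau>_def s_def)
qed

lemma nn_integral_weighted:
  assumes "w \<in> borel_measurable lebesgue" "g \<in> borel_measurable lebesgue"
  shows "(\<integral>\<^sup>+x. g x \<partial>weighted w) = (\<integral>\<^sup>+x. ennreal (w x) * g x \<partial>lebesgue)"
  using assms by (simp add: weighted_def nn_integral_density)

lemma nn_integral_bumped:
  fixes f w :: "real ^ 'n \<Rightarrow> real"
  assumes q: "1 < q" "1 < r" and f: "f \<in> borel_measurable lebesgue"
    and w: "w \<in> borel_measurable lebesgue" "\<And>x. 0 \<le> w x"
  shows "(\<integral>\<^sup>+x. ennreal \<bar>bumped q r w f x\<bar> epowr (q / bump_exp q r) \<partial>lebesgue) =
    (\<integral>\<^sup>+x. ennreal \<bar>f x\<bar> epowr q \<partial>weighted w)"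
proof -
  have s: "1 < bump_exp q r" using bump_exp_bounds q by blast
  have "ennreal \<bar>bumped q r w f x\<bar> epowr (q / bump_exp q r) = ennreal (w x) * ennreal \<bar>f x\<bar> epowr q" for x
  proof -
    have "(\<bar>f x\<bar> * w x powr (1 / q)) powr q = w x * \<bar>f x\<bar> powr q"
      using q w(2)[of x] by (simp add: powr_mult powr_powr)
    then show ?thesis
      using q s w(2)[of x] by (simp add: bumped_def epowr_ennreal powr_powr ennreal_mult[symmetric])
  qed
  then show ?thesis
    using f w(1) by (simp add: nn_integral_weighted)
qed

text \<open>
  The constant weight \<open>1\<close> belongs to every class \<open>A\<^sub>q\<close>.
\<close>
lemma muckenhoupt_bounded_unweighted:
  fixes \<B> :: "(real ^ 'n) set set"
  assumes "muckenhoupt_basis \<B>" and q: "1 < q"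
  obtains C :: real where "\<And>h :: real ^ 'n \<Rightarrow> real. h \<in> borel_measurable lebesgue \<Longrightarrow>
      (\<integral>\<^sup>+x. ennreal \<bar>h x\<bar> epowr q \<partial>lebesgue) < \<infinity> \<Longrightarrow>
      (\<integral>\<^sup>+x. maximal \<B> h x epowr q \<partial>lebesgue) \<le>
        ennreal C * (\<integral>\<^sup>+x. ennreal \<bar>h x\<bar> epowr q \<partial>lebesgue)"
proof -
  have w1: "weighted (\<lambda>_. 1 :: real) = (lebesgue :: (real ^ 'n) measure)"
    by (simp add: weighted_def density_1)
  have \<B>: "is_basis \<B>" using assms(1) by (simp add: muckenhoupt_basis_def)
  have "avg B (\<lambda>_. 1) = 1" if "B \<in> \<B>" for B
    using basis_setD[OF \<B> that] by (simp add: avg_def ennreal_divide_self)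
  then have "(\<lambda>_. 1) \<in> A_class q \<B>"
    using basis_setD[OF \<B>]
    by (auto simp: A_class_def is_weight_def w1 intro!: le_less_trans[OF SUP_least, of _ _ 1])
  then have "bounded_op 1 (\<lambda>f. maximal \<B> (f 1)) (\<lambda>_. q) (\<lambda>_ _. 1) q (\<lambda>_. 1)"
    using assms unfolding muckenhoupt_basis_def by blast
  then obtain C :: real where C: "\<And>f :: nat \<Rightarrow> real ^ 'n \<Rightarrow> real. f 1 \<in> Lspace q (\<lambda>_. 1) \<Longrightarrow>
      Lnorm q (\<lambda>_. 1) (maximal \<B> (f 1)) \<le> ennreal C * Lnorm q (\<lambda>_. 1) (\<lambda>x. ennreal \<bar>f 1 x\<bar>)"
    unfolding bounded_op_def by auto
  show ?thesis
    \<comment> \<open>If \<open>C\<close> is negative, then \<open>ennreal C\<close> is \<open>0\<close>.\<close>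
  proof (rule that[of "max C 0 powr q"])
    fix h :: "real ^ 'n \<Rightarrow> real"
    let ?I = "\<integral>\<^sup>+x. ennreal \<bar>h x\<bar> epowr q \<partial>lebesgue"
    assume h: "h \<in> borel_measurable lebesgue" "?I < \<infinity>"
    have "?I epowr (1 / q) < \<infinity>"
      using h q by (simp add: epowr_less_top_iff)
    then have "h \<in> Lspace q (\<lambda>_. 1)"
      using h by (simp add: Lspace_def Lnorm_def w1)
    then have "Lnorm q (\<lambda>_. 1) (maximal \<B> h) \<le> ennreal C * Lnorm q (\<lambda>_. 1) (\<lambda>x. ennreal \<bar>h x\<bar>)"
      using C[of "\<lambda>_. h"] by simp
    then have "Lnorm q (\<lambda>_. 1) (maximal \<B> h) epowr q \<le>
        (ennreal C * Lnorm q (\<lambda>_. 1) (\<lambda>x. ennreal \<bar>h x\<bar>)) epowr q"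
      using q by (intro epowr_mono) auto
    moreover have "ennreal C epowr q = ennreal (max C 0 powr q)"
      using q by (cases "C \<ge> 0") (auto simp: epowr_ennreal ennreal_neg max_def)
    ultimately show "(\<integral>\<^sup>+x. maximal \<B> h x epowr q \<partial>lebesgue) \<le> ennreal (max C 0 powr q) * ?I"
      using q by (simp add: Lnorm_def w1 epowr_epowr epowr_mult)
  qed
qed

section \<open>The multilinear maximal operator\<close>

text \<open>
  With \<open>\<nu>(B) = |B| avg\<^sub>B \<nu>\<close>, the weight factors produced by \<open>avg_le_bump\<close> for the single \<open>f\<^sub>j\<close>
  combine with \<open>avg\<^sub>B \<nu>\<close> to the expression of the bump condition, leaving \<open>|B|\<close> and averages that
  carry no weight. The lemma \<open>avg_le_bump\<close> needs finite averages of the powers of \<open>w\<^sub>j\<close>; they are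
  finite if \<open>\<nu>(B) \<noteq> 0\<close>, while for \<open>\<nu>(B) = 0\<close> the left-hand side vanishes.
\<close>
lemma bump_term_bound:
  fixes \<nu> :: "real ^ 'n \<Rightarrow> real" and w f :: "'i \<Rightarrow> real ^ 'n \<Rightarrow> real"
  assumes I: "finite I" and B: "is_basis \<B>" "B \<in> \<B>" and \<nu>: "is_weight \<B> \<nu>"
    and w: "\<And>j. j \<in> I \<Longrightarrow> is_weight \<B> (w j)"
    and f: "\<And>j. j \<in> I \<Longrightarrow> f j \<in> borel_measurable lebesgue"
    and p: "0 < p" and q: "\<And>j. j \<in> I \<Longrightarrow> 1 < q j" and r: "1 < r"
    and K: "avg B (\<lambda>x. ennreal (\<nu> x)) *
      (\<Prod>j\<in>I. avg B (\<lambda>x. ennreal (w j x) epowr ((1 - conj_exp (q j)) * r))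
        epowr (p / (conj_exp (q j) * r))) \<le> K" "K < \<infinity>"
  shows "(\<Prod>j\<in>I. avg B (\<lambda>x. ennreal \<bar>f j x\<bar>)) epowr p * emeasure (weighted \<nu>) B \<le>
    K * emeasure lebesgue B *
      (\<Prod>j\<in>I. avg B (\<lambda>x. ennreal \<bar>bumped (q j) r (w j) (f j) x\<bar>) epowr (p / bump_exp (q j) r))"
proof (cases "emeasure (weighted \<nu>) B = 0")
  case True
  then show ?thesis by simp
next
  case False
  note b = basis_setD[OF B]
  let ?W = "\<lambda>j. avg B (\<lambda>x. ennreal (w j x) epowr ((1 - conj_exp (q j)) * r))"
  let ?H = "\<lambda>j. avg B (\<lambda>x. ennreal \<bar>bumped (q j) r (w j) (f j) x\<bar>)"
  let ?\<nu> = "avg B (\<lambda>x. ennreal (\<nu> x))"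
  have wm: "w j \<in> borel_measurable lebesgue" "\<And>x. 0 \<le> w j x" if "j \<in> I" for j
    using w[OF that] by (auto simp: is_weight_def)
  have "emeasure (weighted \<nu>) B = (\<integral>\<^sup>+x\<in>B. ennreal (\<nu> x) \<partial>lebesgue)"
    using \<nu> b(2) unfolding weighted_def is_weight_def by (intro emeasure_density) auto
  then have \<nu>B: "emeasure (weighted \<nu>) B = emeasure lebesgue B * ?\<nu>"
    using b(5,6) by (simp add: avg_def ennreal_times_divide mult.commute[of "emeasure lebesgue B"]
        ennreal_mult_divide_eq less_top)
  with False have \<nu>0: "?\<nu> \<noteq> 0" by auto
  have e: "0 < conj_exp (q j) * r" "0 < p / (conj_exp (q j) * r)" "0 < bump_exp (q j) r" if "j \<in> I" for j
    using conj_exp_gt_1[OF q[OF that]] bump_exp_bounds[OF q[OF that] r] r p by auto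
  have W0: "?W j \<noteq> 0" if j: "j \<in> I" for j
  proof (rule avg_neq_0[OF B])
    show "(\<lambda>x. ennreal (w j x) epowr ((1 - conj_exp (q j)) * r)) \<in> borel_measurable lebesgue"
      using wm(1)[OF j] by measurable
    show "ennreal (w j x) epowr ((1 - conj_exp (q j)) * r) \<noteq> 0" for x
      using conj_exp_gt_1[OF q[OF j]] r by (auto simp: epowr_def enn2real_eq_0_iff mult_less_0_iff)
  qed
  have "(\<Prod>j\<in>I. ?W j epowr (p / (conj_exp (q j) * r))) \<noteq> top"
    using K \<nu>0 by (auto simp: ennreal_mult_eq_top_iff top_unique)
  then have Wfin: "?W j < \<infinity>" if "j \<in> I" for j
    using I W0 e that by (auto simp: ennreal_prod_eq_top epowr_eq_0_iff epowr_eq_top_iff less_top)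
  have "(\<Prod>j\<in>I. avg B (\<lambda>x. ennreal \<bar>f j x\<bar>)) epowr p =
      (\<Prod>j\<in>I. avg B (\<lambda>x. ennreal \<bar>f j x\<bar>) epowr p)"
    using p by (rule epowr_prod)
  also have "\<dots> \<le> (\<Prod>j\<in>I. ?H j epowr (p / bump_exp (q j) r) * ?W j epowr (p / (conj_exp (q j) * r)))"
  proof (rule prod_mono_ennreal)
    fix j assume j: "j \<in> I"
    have "avg B (\<lambda>x. ennreal \<bar>f j x\<bar>) epowr p \<le>
        (?H j epowr (1 / bump_exp (q j) r) * ?W j epowr (1 / (conj_exp (q j) * r))) epowr p"
      by (intro epowr_mono p avg_le_bump[OF B f[OF j] wm[OF j] q[OF j] r Wfin[OF j]])
    also have "\<dots> = ?H j epowr (p / bump_exp (q j) r) * ?W j epowr (p / (conj_exp (q j) * r))"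
      using p e[OF j] by (simp add: epowr_mult epowr_epowr)
    finally show "avg B (\<lambda>x. ennreal \<bar>f j x\<bar>) epowr p \<le> \<dots>" .
  qed
  also have "\<dots> = (\<Prod>j\<in>I. ?H j epowr (p / bump_exp (q j) r)) *
      (\<Prod>j\<in>I. ?W j epowr (p / (conj_exp (q j) * r)))"
    by (rule prod.distrib)
  finally have "(\<Prod>j\<in>I. avg B (\<lambda>x. ennreal \<bar>f j x\<bar>)) epowr p * emeasure (weighted \<nu>) B \<le>
      ((\<Prod>j\<in>I. ?H j epowr (p / bump_exp (q j) r)) *
       (\<Prod>j\<in>I. ?W j epowr (p / (conj_exp (q j) * r)))) * (emeasure lebesgue B * ?\<nu>)"
    unfolding \<nu>B by (rule mult_right_mono) simp
  also have "\<dots> = (?\<nu> * (\<Prod>j\<in>I. ?W j epowr (p / (conj_exp (q j) * r)))) *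
      (emeasure lebesgue B * (\<Prod>j\<in>I. ?H j epowr (p / bump_exp (q j) r)))"
    by (simp add: mult_ac)
  also have "\<dots> \<le> K * (emeasure lebesgue B * (\<Prod>j\<in>I. ?H j epowr (p / bump_exp (q j) r)))"
    by (rule mult_right_mono[OF K(1)]) simp
  finally show ?thesis by (simp add: mult_ac)
qed

text \<open>
  On \<open>E B \<subseteq> B\<close> each average over \<open>B\<close> is at most the maximal function, and the sets \<open>E B\<close> are
  disjoint: this turns the sum over the selected sets into a single unweighted integral.
\<close>
lemma sum_avg_le_nn_integral_maximal:
  fixes h :: "'i \<Rightarrow> real ^ 'n \<Rightarrow> real"
  assumes I: "finite I" and \<B>: "is_basis \<B>" and S: "finite S" "S \<subseteq> \<B>" "disjoint_family_on E S"
    and E: "\<And>B. B \<in> S \<Longrightarrow> E B \<in> sets lebesgue \<and> E B \<subseteq> B"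
    and e: "\<And>j. j \<in> I \<Longrightarrow> 0 < e j"
  shows "(\<Sum>B\<in>S. emeasure lebesgue (E B) * (\<Prod>j\<in>I. avg B (\<lambda>x. ennreal \<bar>h j x\<bar>) epowr e j)) \<le>
    (\<integral>\<^sup>+x. (\<Prod>j\<in>I. maximal \<B> (h j) x epowr e j) \<partial>lebesgue)"
proof -
  let ?a = "\<lambda>B. \<Prod>j\<in>I. avg B (\<lambda>x. ennreal \<bar>h j x\<bar>) epowr e j"
  let ?G = "\<lambda>x. \<Prod>j\<in>I. maximal \<B> (h j) x epowr e j"
  have E_sets: "E B \<in> sets lebesgue" if "B \<in> S" for B using E[OF that] by simp
  have "(\<Sum>B\<in>S. emeasure lebesgue (E B) * ?a B) = (\<Sum>B\<in>S. \<integral>\<^sup>+x. ?a B * indicator (E B) x \<partial>lebesgue)"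
  proof (rule sum.cong[OF refl])
    fix B assume "B \<in> S"
    from nn_integral_cmult_indicator[OF E_sets[OF this], of "?a B"]
    show "emeasure lebesgue (E B) * ?a B = (\<integral>\<^sup>+x. ?a B * indicator (E B) x \<partial>lebesgue)"
      by (simp only: mult.commute[of "?a B" "emeasure lebesgue (E B)"])
  qed
  also have "\<dots> = (\<integral>\<^sup>+x. (\<Sum>B\<in>S. ?a B * indicator (E B) x) \<partial>lebesgue)"
    by (rule nn_integral_sum[symmetric])
       (intro borel_measurable_times_ennreal borel_measurable_const borel_measurable_indicator E_sets)
  also have "\<dots> \<le> (\<integral>\<^sup>+x. ?G x \<partial>lebesgue)"
  proof (rule nn_integral_mono)
    fix x
    have "?a B * indicator (E B) x \<le> ?G x * indicator (E B) x" if "B \<in> S" for B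
    proof (cases "x \<in> E B")
      case True
      then have "B \<in> {B \<in> \<B>. x \<in> B}" using that E[OF that] S(2) by blast
      then have "avg B (\<lambda>x. ennreal \<bar>h j x\<bar>) \<le> maximal \<B> (h j) x" for j
        unfolding maximal_def by (rule SUP_upper)
      then have "?a B \<le> ?G x"
        by (intro prod_mono_ennreal epowr_mono e) auto
      then show ?thesis using True by simp
    qed simp
    then have "(\<Sum>B\<in>S. ?a B * indicator (E B) x) \<le> (\<Sum>B\<in>S. ?G x * indicator (E B) x)"
      by (rule sum_mono)
    also have "\<dots> = ?G x * indicator (\<Union>B\<in>S. E B) x"
      using S by (simp add: indicator_UN_disjoint sum_distrib_left)
    also have "\<dots> \<le> ?G x" by (simp add: indicator_def)
    finally show "(\<Sum>B\<in>S. ?a B * indicator (E B) x) \<le> ?G x" .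
  qed
  finally show ?thesis .
qed

theorem corollary3p3:
  fixes \<B> :: "(real ^ 'n) set set"
    and m :: nat
    and p :: real
    and pj :: "nat \<Rightarrow> real"
    and \<nu> :: "real ^ 'n \<Rightarrow> real"
    and w :: "nat \<Rightarrow> real ^ 'n \<Rightarrow> real"
  assumes "muckenhoupt_basis \<B>"
    and "1 \<le> m"
    and "1 / real m < p"
    and "\<And>j. j \<in> {1..m} \<Longrightarrow> 1 < pj j"
    and "1 / p = (\<Sum>j=1..m. 1 / pj j)"
    and "is_weight \<B> \<nu>"
    and "\<And>j. j \<in> {1..m} \<Longrightarrow> is_weight \<B> (w j)"
    and "\<exists>r>1. (SUP B\<in>\<B>. avg B (\<lambda>x. ennreal (\<nu> x)) *
           (\<Prod>j=1..m. (avg B (\<lambda>x. ennreal (w j x) epowr ((1 - conj_exp (pj j)) * r)))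
                          epowr (p / (conj_exp (pj j) * r)))) < \<infinity>"
    and "condition_A \<B> \<nu>"
  shows "bounded_op m (multi_maximal \<B> m) pj w p \<nu>"
proof -
  have \<B>: "is_basis \<B>" using assms(1) by (simp add: muckenhoupt_basis_def)
  note b = basis_setD[OF \<B>]
  have p: "0 < p" using assms(3) by (rule le_less_trans[rotated]) simp
  note q = assms(4) and \<nu> = assms(6) and w = assms(7)
  have wm: "w j \<in> borel_measurable lebesgue" "\<And>x. 0 \<le> w j x" if "j \<in> {1..m}" for j
    using w[OF that] by (auto simp: is_weight_def)
  obtain r where r: "1 < r" and K_fin: "(SUP B\<in>\<B>. avg B (\<lambda>x. ennreal (\<nu> x)) *
           (\<Prod>j=1..m. (avg B (\<lambda>x. ennreal (w j x) epowr ((1 - conj_exp (pj j)) * r)))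
                          epowr (p / (conj_exp (pj j) * r)))) < \<infinity>" (is "?K < \<infinity>")
    using assms(8) by blast
  obtain l c :: real where l: "0 < l" "l < 1" and A: "\<And>E. E \<in> sets lebesgue \<Longrightarrow>
      emeasure (weighted \<nu>) {x. ennreal l < maximal \<B> (indicat_real E) x} \<le>
        ennreal c * emeasure (weighted \<nu>) E"
    using assms(9) unfolding condition_A_def by blast
  define s where "s j = bump_exp (pj j) r" for j
  have s: "1 < s j" "1 < pj j / s j" if "j \<in> {1..m}" for j
    using bump_exp_bounds[OF q[OF that] r] by (auto simp: s_def)
  have "\<exists>C::real. \<forall>h :: real ^ 'n \<Rightarrow> real. h \<in> borel_measurable lebesgue \<longrightarrow>
      (\<integral>\<^sup>+x. ennreal \<bar>h x\<bar> epowr (pj j / s j) \<partial>lebesgue) < \<infinity> \<longrightarrow>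
      (\<integral>\<^sup>+x. maximal \<B> h x epowr (pj j / s j) \<partial>lebesgue) \<le>
        ennreal C * (\<integral>\<^sup>+x. ennreal \<bar>h x\<bar> epowr (pj j / s j) \<partial>lebesgue)" if "j \<in> {1..m}" for j
    using muckenhoupt_bounded_unweighted[OF assms(1) s(2)[OF that]] by metis
  then obtain C :: "nat \<Rightarrow> real" where C: "\<And>j h. j \<in> {1..m} \<Longrightarrow> h \<in> borel_measurable lebesgue \<Longrightarrow>
      (\<integral>\<^sup>+x. ennreal \<bar>h x\<bar> epowr (pj j / s j) \<partial>lebesgue) < \<infinity> \<Longrightarrow>
      (\<integral>\<^sup>+x. maximal \<B> h x epowr (pj j / s j) \<partial>(lebesgue :: (real ^ 'n) measure)) \<le>
        ennreal (C j) * (\<integral>\<^sup>+x. ennreal \<bar>h x\<bar> epowr (pj j / s j) \<partial>lebesgue)"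
    by metis
  \<comment> \<open>The factors come from condition (A), the bump condition, the sparseness of the selected
    sets and the unweighted bounds for the maximal operator.\<close>
  define D where "D = ennreal c * (?K * ennreal (1 / (1 - l)) * (\<Prod>j=1..m. ennreal (C j) epowr (p / pj j)))"
  have \<theta>: "0 < p / pj j" if "j \<in> {1..m}" for j using p q[OF that] by simp
  have "(\<Prod>j=1..m. ennreal (C j) epowr (p / pj j)) < \<infinity>"
    using \<theta> by (auto simp: ennreal_prod_eq_top epowr_eq_top_iff simp flip: less_top)
  then have "D < \<infinity>"
    unfolding D_def using K_fin by (simp add: ennreal_mult_less_top)
  then have D_fin: "D epowr (1 / p) < \<infinity>" using p by (simp add: epowr_less_top_iff)
  have sum_\<theta>: "(\<Sum>j=1..m. p / pj j) = 1"
  proof -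
    have "(\<Sum>j=1..m. p / pj j) = p * (1 / p)"
      unfolding assms(5) by (simp add: sum_distrib_left)
    then show ?thesis using p by simp
  qed
  have bound: "Lnorm p \<nu> (multi_maximal \<B> m f) \<le>
      D epowr (1 / p) * (\<Prod>j=1..m. Lnorm (pj j) (w j) (\<lambda>x. ennreal \<bar>f j x\<bar>))"
    if f: "\<forall>j\<in>{1..m}. f j \<in> Lspace (pj j) (w j)" for f
  proof -
    define N where "N j = (\<integral>\<^sup>+x. ennreal \<bar>f j x\<bar> epowr pj j \<partial>weighted (w j))" for j
    define h where "h j = bumped (pj j) r (w j) (f j)" for j
    define a where "a B = (\<Prod>j=1..m. avg B (\<lambda>x. ennreal \<bar>f j x\<bar>)) epowr p" for B
    define G where "G x = (\<Prod>j=1..m. maximal \<B> (h j) x epowr (p / s j))" for x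
    have fm: "f j \<in> borel_measurable lebesgue" if "j \<in> {1..m}" for j
      using f that by (simp add: Lspace_def)
    have hm: "h j \<in> borel_measurable lebesgue" if "j \<in> {1..m}" for j
      unfolding h_def using fm[OF that] wm(1)[OF that] by (rule borel_measurable_bumped)
    have hN: "(\<integral>\<^sup>+x. ennreal \<bar>h j x\<bar> epowr (pj j / s j) \<partial>lebesgue) = N j" if "j \<in> {1..m}" for j
      unfolding h_def s_def N_def by (intro nn_integral_bumped q fm wm r that)
    have N_fin: "N j < \<infinity>" if "j \<in> {1..m}" for j
    proof -
      have "N j epowr (1 / pj j) < \<infinity>"
        using f that by (simp add: Lspace_def Lnorm_def N_def)
      then show ?thesis using q[OF that] by (simp add: epowr_less_top_iff)
    qed
    have G_bound: "(\<integral>\<^sup>+x. G x \<partial>lebesgue) \<le>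
        (\<Prod>j=1..m. ennreal (C j) epowr (p / pj j)) * (\<Prod>j=1..m. N j epowr (p / pj j))"
    proof -
      have G_eq: "G x = (\<Prod>j=1..m. (maximal \<B> (h j) x epowr (pj j / s j)) epowr (p / pj j))" for x
        unfolding G_def using s q p
        by (intro prod.cong refl) (subst epowr_epowr, fastforce+)
      have max_meas: "maximal \<B> (h j) \<in> borel_measurable lebesgue" for j
        unfolding maximal_eq_basis_sup using b(1) by (rule borel_measurable_basis_sup)
      have "(\<integral>\<^sup>+x. G x \<partial>lebesgue) \<le>
          (\<Prod>j=1..m. (\<integral>\<^sup>+x. maximal \<B> (h j) x epowr (pj j / s j) \<partial>lebesgue) epowr (p / pj j))"
        unfolding G_eq by (intro nn_integral_Holder \<theta> sum_\<theta> measurable_epowr max_meas) simp_all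
      also have "\<dots> \<le> (\<Prod>j=1..m. (ennreal (C j) * N j) epowr (p / pj j))"
      proof (rule prod_mono_ennreal)
        fix j assume j: "j \<in> {1..m}"
        have "(\<integral>\<^sup>+x. maximal \<B> (h j) x epowr (pj j / s j) \<partial>lebesgue) \<le> ennreal (C j) * N j"
          using C[OF j hm[OF j]] N_fin[OF j] unfolding hN[OF j] by blast
        then show "(\<integral>\<^sup>+x. maximal \<B> (h j) x epowr (pj j / s j) \<partial>lebesgue) epowr (p / pj j) \<le>
            (ennreal (C j) * N j) epowr (p / pj j)"
          by (rule epowr_mono[OF \<theta>[OF j]])
      qed
      also have "\<dots> = (\<Prod>j=1..m. ennreal (C j) epowr (p / pj j) * N j epowr (p / pj j))"
        by (rule prod.cong[OF refl]) (rule epowr_mult[OF \<theta>])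
      finally show ?thesis by (simp add: prod.distrib)
    qed
    have families: "(\<integral>\<^sup>+x. basis_sup F a x \<partial>weighted \<nu>) \<le> D * (\<Prod>j=1..m. N j epowr (p / pj j))"
      if F: "finite F" "F \<subseteq> \<B>" for F
    proof -
      obtain S E where S: "S \<subseteq> F" "disjoint_family_on E S"
        and E: "\<And>B. B \<in> S \<Longrightarrow> E B \<in> sets lebesgue \<and> E B \<subseteq> B \<and>
          emeasure lebesgue B \<le> ennreal (1 / (1 - l)) * emeasure lebesgue (E B)"
        and FS: "(\<integral>\<^sup>+x. basis_sup F a x \<partial>weighted \<nu>) \<le>
          ennreal c * (\<Sum>B\<in>S. a B * emeasure (weighted \<nu>) B)"
        by (rule covering_bound[OF \<B> \<nu> l _ F, where c = "ennreal c" and a = a])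
           (erule A, rule that)
      let ?P = "\<lambda>B. \<Prod>j=1..m. avg B (\<lambda>x. ennreal \<bar>h j x\<bar>) epowr (p / s j)"
      have "a B * emeasure (weighted \<nu>) B \<le>
          (?K * ennreal (1 / (1 - l))) * (emeasure lebesgue (E B) * ?P B)" if "B \<in> S" for B
      proof -
        have B: "B \<in> \<B>" using that S(1) F(2) by auto
        have "a B * emeasure (weighted \<nu>) B \<le> ?K * emeasure lebesgue B * ?P B"
          unfolding a_def h_def s_def
          by (intro bump_term_bound[OF _ \<B> B \<nu> w fm p q r _ K_fin] SUP_upper B) auto
        also have "\<dots> \<le> ?K * (ennreal (1 / (1 - l)) * emeasure lebesgue (E B)) * ?P B"
          using E[OF that] by (intro mult_left_mono mult_right_mono) auto
        finally show ?thesis by (simp only: mult_ac)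
      qed
      then have "(\<Sum>B\<in>S. a B * emeasure (weighted \<nu>) B) \<le>
          (\<Sum>B\<in>S. (?K * ennreal (1 / (1 - l))) * (emeasure lebesgue (E B) * ?P B))"
        by (rule sum_mono)
      also have "\<dots> = ?K * ennreal (1 / (1 - l)) * (\<Sum>B\<in>S. emeasure lebesgue (E B) * ?P B)"
        by (rule sum_distrib_left[symmetric])
      also have "\<dots> \<le> ?K * ennreal (1 / (1 - l)) * (\<integral>\<^sup>+x. G x \<partial>lebesgue)"
        unfolding G_def
      proof (intro mult_left_mono sum_avg_le_nn_integral_maximal \<B> S(2))
        show "finite S" "S \<subseteq> \<B>" using S(1) F by (auto intro: finite_subset)
        show "0 < p / s j" if "j \<in> {1..m}" for j using p s(1)[OF that] by simp
      qed (use E in auto)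
      also have "\<dots> \<le> ?K * ennreal (1 / (1 - l)) *
          ((\<Prod>j=1..m. ennreal (C j) epowr (p / pj j)) * (\<Prod>j=1..m. N j epowr (p / pj j)))"
        by (intro mult_left_mono G_bound) simp
      finally have "ennreal c * (\<Sum>B\<in>S. a B * emeasure (weighted \<nu>) B) \<le>
          ennreal c * (?K * ennreal (1 / (1 - l)) *
            ((\<Prod>j=1..m. ennreal (C j) epowr (p / pj j)) * (\<Prod>j=1..m. N j epowr (p / pj j))))"
        by (rule mult_left_mono) simp
      with FS show ?thesis unfolding D_def mult.assoc by (rule order_trans)
    qed
    have powers: "multi_maximal \<B> m f x epowr p = basis_sup \<B> a x" for x
      unfolding multi_maximal_def basis_sup_def a_def using p by (rule epowr_SUP)
    have "(\<integral>\<^sup>+x. multi_maximal \<B> m f x epowr p \<partial>weighted \<nu>) \<le>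
        D * (\<Prod>j=1..m. N j epowr (p / pj j))"
      unfolding powers by (rule nn_integral_basis_sup_le[OF b(1) sets_weighted families])
    then have "Lnorm p \<nu> (multi_maximal \<B> m f) \<le>
        (D * (\<Prod>j=1..m. N j epowr (p / pj j))) epowr (1 / p)"
      unfolding Lnorm_def using p by (intro epowr_mono) simp_all
    also have "\<dots> = D epowr (1 / p) * (\<Prod>j=1..m. (N j epowr (p / pj j)) epowr (1 / p))"
    proof -
      have "0 < 1 / p" using p by simp
      then show ?thesis by (simp only: epowr_mult epowr_prod)
    qed
    also have "(\<Prod>j=1..m. (N j epowr (p / pj j)) epowr (1 / p)) =
        (\<Prod>j=1..m. Lnorm (pj j) (w j) (\<lambda>x. ennreal \<bar>f j x\<bar>))"
    proof (rule prod.cong[OF refl])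
      fix j assume j: "j \<in> {1..m}"
      have "(N j epowr (p / pj j)) epowr (1 / p) = N j epowr (1 / pj j)"
        using p \<theta>[OF j] by (simp add: epowr_epowr)
      then show "(N j epowr (p / pj j)) epowr (1 / p) = Lnorm (pj j) (w j) (\<lambda>x. ennreal \<bar>f j x\<bar>)"
        by (simp only: Lnorm_def N_def)
    qed
    finally show ?thesis .
  qed
  have "multi_maximal \<B> m f = basis_sup \<B> (\<lambda>B. \<Prod>j=1..m. avg B (\<lambda>y. ennreal \<bar>f j y\<bar>))" for f
    by (simp add: fun_eq_iff multi_maximal_def basis_sup_def)
  then have meas: "multi_maximal \<B> m f \<in> borel_measurable lebesgue" for f
    using borel_measurable_basis_sup[OF b(1)] by simp
  have D_real: "ennreal (enn2real (D epowr (1 / p))) = D epowr (1 / p)"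
    using D_fin by simp
  show ?thesis
    unfolding bounded_op_def
  proof (intro exI allI impI conjI)
    fix f assume f: "\<forall>j\<in>{1..m}. f j \<in> Lspace (pj j) (w j)"
    show "Lnorm p \<nu> (multi_maximal \<B> m f) \<le> ennreal (enn2real (D epowr (1 / p))) *
        (\<Prod>j=1..m. Lnorm (pj j) (w j) (\<lambda>x. ennreal \<bar>f j x\<bar>))"
      unfolding D_real by (rule bound[OF f])
  qed (rule meas)
qed

end
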